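(* There exists an oracle $A$ such that (the set $A$, which lies in $\mathrm{P}^A$) $A$ is not $A$-scalable and $\mathrm{census}_A\in\mathrm{FP}^A$.
   Context: Strings are over $\Sigma=\{0,1\}$, with $\le$ the standard lexicographic order. $\mathrm{census}_A(1^n)=|\{x\in A:|x|=n\}|$. A set is rankable in $\mathrm{FP}^X$ if its ranking function $x\mapsto|\{y\le x:y\in$ set$\}|$ is computable by a deterministic polynomial-time oracle transducer with oracle $X$. A $\mathrm{P}^X$-isomorphism is a bijection $\phi:\Sigma^*\to\Sigma^*$ with $\phi,\phi^{-1}\in\mathrm{FP}^X$. A set is $X$-scalable if there is a $\mathrm{P}^X$-isomorphism mapping it onto some set rankable in $\mathrm{FP}^X$. *)

theory Defs
  imports "HOL-Computational_Algebra.Polynomial" "HOL-Library.List_Lenlexorder"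
begin

text \<open>
  Strings over \<open>{0,1}\<close> are boolean lists, with \<open>False\<close> for 0 and \<open>True\<close> for 1. The imported
  order \<open>\<le>\<close> on lists compares lengths first and then lexicographically, i.e. it is the
  enumeration order \<open>\<epsilon>, 0, 1, 00, 01, \<dots>\<close>; every string has finitely many predecessors.
\<close>

datatype sym = Blank | is_Bit: Bit (bit_of: bool) | Mark nat

datatype move = MoveLeft | Stay | MoveRight

text \<open>
  Deterministic multitape oracle transducers. Tapes are infinite to the right.
  Tape 0 initially holds the input, tape 1 is the query tape, tape 2 is the output tape, and all
  further tapes are work tapes; all tapes can be read and written. Symbols \<open>Mark i\<close> are the
  additional tape symbols. Finiteness of the domain of the transition function makes the sets of
  states and symbols used by a machine finite.
\<close>

record otm =
  ntapes :: nat
  start_state :: nat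
  query_state :: nat
  yes_state :: nat
  no_state :: nat
  delta :: "nat \<times> sym list \<Rightarrow> (nat \<times> (sym \<times> move) list) option"

definition wf_otm :: "otm \<Rightarrow> bool" where
  "wf_otm M \<longleftrightarrow> ntapes M \<ge> 3 \<and> finite (dom (delta M)) \<and>
     (\<forall>q ss q' as. delta M (q, ss) = Some (q', as) \<longrightarrow> length as = ntapes M)"

record tape =
  head :: nat
  cells :: "nat \<Rightarrow> sym"

record config =
  state :: nat
  tapes :: "tape list"

definition read :: "tape \<Rightarrow> sym" where
  "read T = cells T (head T)"

fun move_head :: "move \<Rightarrow> nat \<Rightarrow> nat" where
  "move_head MoveLeft h = h - 1"
| "move_head Stay h = h"
| "move_head MoveRight h = h + 1"

definition act :: "sym \<times> move \<Rightarrow> tape \<Rightarrow> tape" where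
  "act a T = \<lparr>head = move_head (snd a) (head T), cells = (cells T)(head T := fst a)\<rparr>"

text \<open>The string written on a tape extends from cell 0 to the first cell not holding a bit.\<close>

definition tape_string :: "tape \<Rightarrow> bool list" where
  "tape_string T = map (\<lambda>i. bit_of (cells T i)) [0..<(LEAST n. \<not> is_Bit (cells T n))]"

definition string_tape :: "bool list \<Rightarrow> tape" where
  "string_tape x = \<lparr>head = 0, cells = (\<lambda>i. if i < length x then Bit (x ! i) else Blank)\<rparr>"

definition init :: "otm \<Rightarrow> bool list \<Rightarrow> config" where
  "init M x = \<lparr>state = start_state M,
     tapes = string_tape x # replicate (ntapes M - 1) (string_tape [])\<rparr>"

definition halted :: "otm \<Rightarrow> config \<Rightarrow> bool" where
  "halted M c \<longleftrightarrow>
     state c \<noteq> query_state M \<and> delta M (state c, map read (tapes c)) = None"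

text \<open>
  In the query state one step consults the oracle about the string on the query tape and leaves
  all tapes unchanged. Halted configurations are fixed points.
\<close>

definition step :: "otm \<Rightarrow> bool list set \<Rightarrow> config \<Rightarrow> config" where
  "step M X c =
     (if state c = query_state M
      then c\<lparr>state := if tape_string (tapes c ! 1) \<in> X then yes_state M else no_state M\<rparr>
      else case delta M (state c, map read (tapes c)) of
        None \<Rightarrow> c
      | Some (q, as) \<Rightarrow> \<lparr>state = q, tapes = map2 act as (tapes c)\<rparr>)"

definition outputs_within ::
    "otm \<Rightarrow> bool list set \<Rightarrow> bool list \<Rightarrow> nat \<Rightarrow> bool list \<Rightarrow> bool" where
  "outputs_within M X x t y \<longleftrightarrow>
     (\<exists>s\<le>t. let c = (step M X ^^ s) (init M x)
            in halted M c \<and> tape_string (tapes c ! 2) = y)"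

text \<open>
  \<open>FP X e d\<close> is the set of functions in FP relative to the oracle \<open>X\<close>, where arguments are
  presented to the machine through the encoding \<open>e\<close> and values through the encoding \<open>d\<close>.
\<close>

definition FP :: "bool list set \<Rightarrow> ('a \<Rightarrow> bool list) \<Rightarrow> ('b \<Rightarrow> bool list) \<Rightarrow> ('a \<Rightarrow> 'b) set" where
  "FP X e d = {f. \<exists>M (p :: nat poly). wf_otm M \<and>
     (\<forall>a. outputs_within M X (e a) (poly p (length (e a))) (d (f a)))}"

definition unary :: "nat \<Rightarrow> bool list" where
  "unary n = replicate n True"

text \<open>Binary notation, most significant bit first and without superfluous leading zeros.\<close>

fun binary :: "nat \<Rightarrow> bool list" where
  "binary n = (if n < 2 then [n = 1] else binary (n div 2) @ [odd n])"

declare binary.simps [simp del]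

abbreviation FP_string :: "bool list set \<Rightarrow> (bool list \<Rightarrow> bool list) set" where
  "FP_string X \<equiv> FP X (\<lambda>x. x) (\<lambda>y. y)"

definition PTIME :: "bool list set \<Rightarrow> bool list set set" where
  "PTIME X = {S. (\<lambda>x. x \<in> S) \<in> FP X (\<lambda>x. x) (\<lambda>b. [b])}"

definition census :: "bool list set \<Rightarrow> nat \<Rightarrow> nat" where
  "census S n = card {x \<in> S. length x = n}"

definition rank :: "bool list set \<Rightarrow> bool list \<Rightarrow> nat" where
  "rank S x = card {y \<in> S. y \<le> x}"

definition rankable :: "bool list set \<Rightarrow> bool list set \<Rightarrow> bool" where
  "rankable X S \<longleftrightarrow> rank S \<in> FP X (\<lambda>x. x) binary"

definition P_isomorphism :: "bool list set \<Rightarrow> (bool list \<Rightarrow> bool list) \<Rightarrow> bool" where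
  "P_isomorphism X \<phi> \<longleftrightarrow> bij \<phi> \<and> \<phi> \<in> FP_string X \<and> inv \<phi> \<in> FP_string X"

definition scalable :: "bool list set \<Rightarrow> bool list set \<Rightarrow> bool" where
  "scalable X S \<longleftrightarrow> (\<exists>\<phi>. P_isomorphism X \<phi> \<and> rankable X (\<phi> ` S))"

end

theory Submission
  imports Complex_Main Defs "HOL-Library.Countable_Set" "HOL-Library.FuncSet"
begin

text \<open>
  The oracle contains exactly one string \<open>W n\<close> of each length \<open>n\<close>, so its census is constant. If \<open>\<phi>\<close>
  were an isomorphism onto a rankable set, then \<open>W n\<close> could be found with polynomially many
  queries: \<open>\<phi> (W n)\<close> has polynomial length, hence polynomial rank in the sparse set \<open>\<phi> ` range W\<close>, so
  a binary search for the element of each small rank, followed by the inverse of \<open>\<phi>\<close>, produces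
  \<open>W n\<close>. This search can also be run, to no purpose, on the oracle from which \<open>W n\<close> has been
  removed; if \<open>W n\<close> is then chosen outside the fewer than \<open>2 ^ n\<close> strings queried or produced there,
  restoring it does not change the outcome. Countably many such requirements are met by choosing
  the lengths \<open>n\<close> sparsely.

  Query complexity is replaced by the weaker notion of certificate complexity, which composes in the
  same way and does not require modelling query sequences.
\<close>

section \<open>Certificate complexity\<close>

text \<open>The finite set \<open>C\<close> is a certificate for the value at \<open>X\<close>: its
  membership answers alone force that value. It may depend on \<open>X\<close>; the queries of a
  computation would be one example.\<close>

definition certifiable :: "nat \<Rightarrow> ('q set \<Rightarrow> 'a) \<Rightarrow> bool" where
  "certifiable c F \<longleftrightarrow>
     (\<forall>X. \<exists>C. finite C \<and> card C \<le> c \<and> (\<forall>Y. (\<forall>q\<in>C. q \<in> Y \<longleftrightarrow> q \<in> X) \<longrightarrow> F Y = F X))"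

lemma certifiableE:
  assumes "certifiable c F"
  obtains C where "finite C" "card C \<le> c" "\<And>Y. (\<And>q. q \<in> C \<Longrightarrow> q \<in> Y \<longleftrightarrow> q \<in> X) \<Longrightarrow> F Y = F X"
  using assms unfolding certifiable_def by meson

lemma certifiable_const: "certifiable c (\<lambda>X. a)"
  unfolding certifiable_def by (intro allI exI[of _ "{}"]) auto

lemma certifiable_mono: "certifiable c F \<Longrightarrow> c \<le> d \<Longrightarrow> certifiable d F"
  unfolding certifiable_def by (meson le_trans)

text \<open>At \<open>X\<close>, a certificate for \<open>F\<close> pins the value
  \<open>F X\<close>, and one for \<open>G (F X)\<close> then pins the rest; their union serves.
  This is adaptive querying, so the second certificate may depend on the first value.\<close>

lemma certifiable_bind:
  assumes F: "certifiable c F" and G: "\<And>a. certifiable d (G a)"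
  shows "certifiable (c + d) (\<lambda>X. G (F X) X)"
  unfolding certifiable_def
proof
  fix X
  obtain C where C: "finite C" "card C \<le> c"
    "\<And>Y. (\<And>q. q \<in> C \<Longrightarrow> q \<in> Y \<longleftrightarrow> q \<in> X) \<Longrightarrow> F Y = F X"
    using certifiableE[OF F] by blast
  obtain D where D: "finite D" "card D \<le> d"
    "\<And>Y. (\<And>q. q \<in> D \<Longrightarrow> q \<in> Y \<longleftrightarrow> q \<in> X) \<Longrightarrow> G (F X) Y = G (F X) X"
    using certifiableE[OF G[of "F X"]] by blast
  have "card (C \<union> D) \<le> c + d"
    using card_Un_le[of C D] C(2) D(2) by linarith
  moreover have "G (F Y) Y = G (F X) X" if "\<forall>q\<in>C \<union> D. q \<in> Y \<longleftrightarrow> q \<in> X" for Y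
  proof -
    have "F Y = F X" by (rule C(3)) (use that in blast)
    moreover have "G (F X) Y = G (F X) X" by (rule D(3)) (use that in blast)
    ultimately show ?thesis by (rule ssubst)
  qed
  ultimately show "\<exists>E. finite E \<and> card E \<le> c + d \<and>
      (\<forall>Y. (\<forall>q\<in>E. q \<in> Y \<longleftrightarrow> q \<in> X) \<longrightarrow> G (F Y) Y = G (F X) X)"
    using C(1) D(1) by (intro exI[of _ "C \<union> D"]) blast
qed

lemma certifiable_comp:
  assumes "certifiable c F"
  shows "certifiable c (\<lambda>X. g (F X))"
  using certifiable_bind[OF assms, of 0 "\<lambda>a X. g a"] by (simp add: certifiable_const)

lemma certifiable_image:
  assumes "finite I" and "\<And>i. i \<in> I \<Longrightarrow> certifiable d (F i)"
  shows "certifiable (card I * d) (\<lambda>X. (\<lambda>i. F i X) ` I)"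
  using assms
proof (induction I rule: finite_induct)
  case empty
  then show ?case by (simp add: certifiable_const)
next
  case (insert i I)
  then have i: "certifiable d (F i)" and I: "certifiable (card I * d) (\<lambda>X. (\<lambda>i. F i X) ` I)"
    by auto
  have "certifiable (d + card I * d) (\<lambda>X. insert (F i X) ((\<lambda>i. F i X) ` I))"
    by (rule certifiable_bind[where G = "\<lambda>a X. insert a ((\<lambda>i. F i X) ` I)", OF i])
      (rule certifiable_comp[OF I])
  then show ?case
    using insert by simp
qed

section \<open>Runs of oracle machines\<close>

text \<open>The oracle can influence one step only through the string on the query tape.\<close>

lemma certifiable_step: "certifiable 1 (\<lambda>X. step M X c)"
  unfolding certifiable_def
  by (intro allI exI[of _ "{tape_string (tapes c ! 1)}"]) (auto simp: step_def)

lemma certifiable_steps: "certifiable t (\<lambda>X. (step M X ^^ t) c)"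
proof (induction t)
  case 0
  then show ?case by (simp add: certifiable_const)
next
  case (Suc t)
  have "certifiable (t + 1) (\<lambda>X. step M X ((step M X ^^ t) c))"
    by (rule certifiable_bind[where G = "\<lambda>c X. step M X c"]) (intro Suc.IH certifiable_step)+
  then show ?case by simp
qed

text \<open>Reading the output after exactly \<open>t\<close> steps, halted or not, gives a total
  function of the oracle. This matters because the search is also run on oracles for which the
  machines guarantee nothing.\<close>

definition result :: "otm \<Rightarrow> nat \<Rightarrow> bool list \<Rightarrow> bool list set \<Rightarrow> bool list" where
  "result M t x X = tape_string (tapes ((step M X ^^ t) (init M x)) ! 2)"

lemma certifiable_result: "certifiable t (result M t x)"
  unfolding result_def by (rule certifiable_comp) (rule certifiable_steps)

lemma halted_steps:
  assumes "halted M c"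
  shows "(step M X ^^ t) c = c"
  using assms by (induction t) (auto simp: step_def halted_def)

lemma outputs_within_result:
  assumes "outputs_within M X x t y" and "t \<le> t'"
  shows "result M t' x X = y"
proof -
  from assms(1) obtain s where s: "s \<le> t" "halted M ((step M X ^^ s) (init M x))"
    "tape_string (tapes ((step M X ^^ s) (init M x)) ! 2) = y"
    unfolding outputs_within_def Let_def by blast
  have "(step M X ^^ t') (init M x) = (step M X ^^ (t' - s)) ((step M X ^^ s) (init M x))"
    using s(1) assms(2) by (metis add.commute comp_apply funpow_add le_add_diff_inverse le_trans)
  then show ?thesis
    using s halted_steps by (simp add: result_def)
qed

lemma length_tapes_step:
  assumes "wf_otm M" "length (tapes c) = ntapes M"
  shows "length (tapes (step M X c)) = ntapes M"
  using assms by (auto simp: step_def wf_otm_def split: option.splits)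

text \<open>A head advances by at most one cell per step, so the non-blank region grows by at most
  one cell.\<close>

lemma blank_beyond_step:
  assumes "wf_otm M" "length (tapes c) = ntapes M" "i < ntapes M"
    and "head (tapes c ! i) \<le> n" "\<And>k. k \<ge> n \<Longrightarrow> cells (tapes c ! i) k = Blank"
  shows "head (tapes (step M X c) ! i) \<le> Suc n"
    and "\<And>k. k \<ge> Suc n \<Longrightarrow> cells (tapes (step M X c) ! i) k = Blank"
proof -
  have "tapes (step M X c) = tapes c \<or> (\<exists>as. length as = ntapes M \<and> tapes (step M X c) = map2 act as (tapes c))"
    using assms(1) by (force simp: step_def wf_otm_def split: option.splits)
  moreover have "move_head v h \<le> Suc n" if "h \<le> n" for v h
    using that by (cases v) auto
  ultimately show "head (tapes (step M X c) ! i) \<le> Suc n"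
    and "\<And>k. k \<ge> Suc n \<Longrightarrow> cells (tapes (step M X c) ! i) k = Blank"
    using assms(2-) by (auto simp: act_def)
qed

lemma blank_beyond_steps:
  fixes x X
  assumes "wf_otm M"
  defines "c \<equiv> \<lambda>t. (step M X ^^ t) (init M x)"
  shows "length (tapes (c t)) = ntapes M \<and> head (tapes (c t) ! 2) \<le> t \<and>
    (\<forall>k\<ge>t. cells (tapes (c t) ! 2) k = Blank)"
proof (induction t)
  case 0
  have "ntapes M \<ge> 3"
    using assms(1) by (simp add: wf_otm_def)
  then show ?case
    by (auto simp: c_def init_def string_tape_def nth_Cons')
next
  case (Suc t)
  have "2 < ntapes M"
    using assms(1) by (simp add: wf_otm_def)
  then show ?case
    using Suc blank_beyond_step[OF assms(1), of "c t" 2 t] length_tapes_step[OF assms(1), of "c t"]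
    by (simp add: c_def)
qed

lemma length_result_le:
  assumes "wf_otm M"
  shows "length (result M t x X) \<le> t"
  unfolding result_def tape_string_def
  \<comment> \<open>Cell \<open>t\<close> of the output tape is blank, so the least non-bit cell is
    at most \<open>t\<close>.\<close>
  using blank_beyond_steps[OF assms, of t X x] by (auto intro!: Least_le)

section \<open>Searching with a ranking function\<close>

text \<open>If \<open>P\<close> is upward closed among the strings of length \<open>length x + j\<close>, this finds the least
  extension of \<open>x\<close> in \<open>P\<close>; the last extension is returned if there is none.\<close>

fun prefix_search :: "(bool list \<Rightarrow> bool) \<Rightarrow> nat \<Rightarrow> bool list \<Rightarrow> bool list" where
  "prefix_search P 0 x = x"
| "prefix_search P (Suc j) x = prefix_search P j (x @ [\<not> P (x @ False # replicate j True)])"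

lemma append_le_append_iff: "x @ y \<le> x @ z \<longleftrightarrow> y \<le> z" if "length y = length z"
  for y z :: "bool list"
  using that by (induction x) (auto simp: Cons_le_Cons)

lemma le_replicate_True: "y \<le> replicate (length y) True"
  by (induction y) (auto simp: Cons_le_Cons)

lemma prefix_search_eq:
  assumes "\<And>y. length y = length x + length z \<Longrightarrow> P y \<longleftrightarrow> x @ z \<le> y"
  shows "prefix_search P (length z) x = x @ z"
  using assms
proof (induction z arbitrary: x)
  case (Cons b z)
  \<comment> \<open>The tested string is the greatest extension of \<open>x\<close> that continues
    with 0; it lies at or above the target exactly when the next target bit is 0.\<close>
  have "P (x @ False # replicate (length z) True) \<longleftrightarrow> \<not> b"
    by (subst Cons.prems)
      (auto simp: append_le_append_iff Cons_le_Cons le_replicate_True)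
  moreover have "prefix_search P (length z) (x @ [b]) = (x @ [b]) @ z"
    by (rule Cons.IH) (simp add: Cons.prems)
  ultimately show ?case
    by simp
qed simp

lemma certifiable_prefix_search:
  assumes "\<And>y. certifiable d (\<lambda>X. P X y)"
  shows "certifiable (j * d) (\<lambda>X. prefix_search (P X) j x)"
proof (induction j arbitrary: x)
  case 0
  then show ?case by (simp add: certifiable_const)
next
  case (Suc j)
  have "certifiable (d + j * d) (\<lambda>X. prefix_search (P X) j (x @ [\<not> P X (x @ False # replicate j True)]))"
    by (rule certifiable_bind[where G = "\<lambda>a X. prefix_search (P X) j (x @ [\<not> a])"])
      (auto intro: assms Suc.IH)
  then show ?case by simp
qed

text \<open>Injectivity lets a rank be compared with \<open>k\<close> directly on its output string,
  by membership in the image of \<open>{k..}\<close>.\<close>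

lemma inj_binary: "inj binary"
proof -
  have "binary m = binary n \<Longrightarrow> m = n" for m n
  proof (induction m arbitrary: n rule: less_induct)
    case (less m)
    have nonempty: "binary k \<noteq> []" for k
      by (subst binary.simps) auto
    show ?case
    proof (cases "m < 2 \<or> n < 2")
      case True
      then show ?thesis
        using less.prems nonempty nonempty[symmetric] by (subst (asm) (1 2) binary.simps) (auto split: if_splits)
    next
      case False
      then have "binary (m div 2) = binary (n div 2)" and "odd m = odd n"
        using less.prems by (subst (asm) (1 2) binary.simps; simp)+
      then have "m div 2 = n div 2"
        using False less.IH[of "m div 2"] by simp
      then show ?thesis
        using \<open>odd m = odd n\<close> by presburger
    qed
  qed
  then show ?thesis by (auto simp: inj_def)
qed

text \<open>Given machines \<open>R\<close> and \<open>G\<close> for a ranking function and for the inverse of an isomorphism, look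
  for the \<open>k\<close>-th element of the ranked set, supposed to have length \<open>j\<close>, and pull it back.\<close>

definition candidates ::
    "otm \<Rightarrow> nat \<Rightarrow> otm \<Rightarrow> nat \<Rightarrow> nat \<Rightarrow> nat \<Rightarrow> bool list set \<Rightarrow> bool list set" where
  "candidates R t G s K m X =
     (\<lambda>(k, j). result G s (prefix_search (\<lambda>y. result R t y X \<in> binary ` {k..}) j []) X) ` ({..K} \<times> {..m})"

text \<open>For each of the \<open>Suc K * Suc m\<close> pairs, the search makes at most
  \<open>m\<close> tests of cost \<open>t\<close>, and pulling back costs \<open>s\<close>.\<close>

lemma certifiable_candidates:
  "certifiable (Suc K * Suc m * (m * t + s)) (candidates R t G s K m)"
proof -
  have "certifiable (m * t + s)
      (\<lambda>X. result G s (prefix_search (\<lambda>y. result R t y X \<in> binary ` {k..}) j []) X)"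
    if "j \<le> m" for k j
  proof (rule certifiable_bind[OF _ certifiable_result])
    have "certifiable (j * t) (\<lambda>X. prefix_search (\<lambda>y. result R t y X \<in> binary ` {k..}) j [])"
      by (rule certifiable_prefix_search) (rule certifiable_comp[OF certifiable_result])
    then show "certifiable (m * t) (\<lambda>X. prefix_search (\<lambda>y. result R t y X \<in> binary ` {k..}) j [])"
      by (rule certifiable_mono) (use that in simp)
  qed
  then have "certifiable (card ({..K} \<times> {..m}) * (m * t + s))
      (\<lambda>X. (\<lambda>i. (case i of (k, j) \<Rightarrow> \<lambda>X. result G s
         (prefix_search (\<lambda>y. result R t y X \<in> binary ` {k..}) j []) X) X) ` ({..K} \<times> {..m}))"
    by (intro certifiable_image) (auto split: prod.splits)
  then show ?thesis
    by (simp add: candidates_def[abs_def] split_beta card_cartesian_product)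
qed

lemma card_candidates_le: "card (candidates R t G s K m X) \<le> Suc K * Suc m"
  and finite_candidates: "finite (candidates R t G s K m X)"
  unfolding candidates_def using card_image_le[of "{..K} \<times> {..m}"]
  by (auto simp: card_cartesian_product)

section \<open>Polynomials and countability\<close>

text \<open>Used to replace the time bounds for inputs of varying length by one bound at the maximal
  length.\<close>

lemma poly_nat_mono:
  fixes p :: "nat poly"
  assumes "m \<le> n"
  shows "poly p m \<le> poly p n"
  using assms by (induction p) (auto intro: mult_mono)

lemma eventually_poly_less_power_two:
  fixes p :: "nat poly"
  shows "\<forall>\<^sub>F n in sequentially. poly p n < 2 ^ n"
proof -
  have "(\<lambda>n. real n ^ i / 2 ^ n) \<longlonglongrightarrow> 0" for i
  proof -
    \<comment> \<open>Each monomial is handled by substituting \<open>n * ln 2\<close> into the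
      limit of \<open>x ^ i / exp x\<close>, since \<open>2 ^ n = exp (n * ln 2)\<close>.\<close>
    have "filterlim (\<lambda>n. real n * ln 2) at_top sequentially"
      using filterlim_tendsto_pos_mult_at_top[OF tendsto_const _ filterlim_real_sequentially, of "ln 2"]
      by (simp add: mult.commute)
    from filterlim_compose[OF tendsto_power_div_exp_0 this]
    have "(\<lambda>n. (real n * ln 2) ^ i / exp (real n * ln 2) / ln 2 ^ i) \<longlonglongrightarrow> 0 / ln 2 ^ i"
      by (rule tendsto_divide) auto
    then show ?thesis
      by (simp add: power_mult_distrib exp_of_nat_mult)
  qed
  then have "(\<lambda>n. \<Sum>i\<le>degree p. real (coeff p i) * (real n ^ i / 2 ^ n)) \<longlonglongrightarrow>
      (\<Sum>i\<le>degree p. real (coeff p i) * 0)"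
    by (intro tendsto_sum tendsto_mult tendsto_const)
  moreover have "real (poly p n) / 2 ^ n = (\<Sum>i\<le>degree p. real (coeff p i) * (real n ^ i / 2 ^ n))" for n
    by (simp add: poly_altdef sum_divide_distrib)
  ultimately have "(\<lambda>n. real (poly p n) / 2 ^ n) \<longlonglongrightarrow> 0"
    by simp
  then have "\<forall>\<^sub>F n in sequentially. real (poly p n) / 2 ^ n < 1"
    by (rule order_tendstoD) simp
  then show ?thesis
  proof eventually_elim
    case (elim n)
    then have "real (poly p n) < real (2 ^ n)"
      by (simp add: divide_less_eq)
    then show ?case by (simp only: of_nat_less_iff)
  qed
qed

instance sym :: countable
  by countable_datatype

instance move :: countable
  by countable_datatype

text \<open>A transition function with finite domain is \<open>map_of\<close> of a finite list, so
  machines are coded by a countable type.\<close>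

lemma countable_wf_otm: "countable {M. wf_otm M}"
proof -
  define machine :: "nat \<times> nat \<times> nat \<times> nat \<times> nat \<times> _ \<Rightarrow> otm" where
    "machine = (\<lambda>(n, s, q, y, r, l). \<lparr>ntapes = n, start_state = s, query_state = q,
       yes_state = y, no_state = r, delta = map_of l\<rparr>)"
  have "{M. wf_otm M} \<subseteq> range machine"
  proof
    fix M
    assume "M \<in> {M. wf_otm M}"
    then have "finite (dom (delta M))"
      by (simp add: wf_otm_def)
    then obtain ks where ks: "set ks = dom (delta M)"
      using finite_list by metis
    define l where "l = map (\<lambda>k. (k, the (delta M k))) ks"
    have "map_of l k = delta M k" for k
      unfolding l_def map_of_map_restrict using ks by (cases "delta M k") (auto simp: restrict_map_def)
    then have "map_of l = delta M"
      by (rule ext)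
    then have "M = machine (ntapes M, start_state M, query_state M, yes_state M, no_state M, l)"
      by (simp add: machine_def)
    then show "M \<in> range machine"
      by (rule range_eqI)
  qed
  then show ?thesis
    by (rule countable_subset) (rule countable_image, rule countableI_type)
qed

lemma countable_poly: "countable (UNIV :: nat poly set)"
proof -
  have "UNIV \<subseteq> range (Poly :: nat list \<Rightarrow> nat poly)"
    by (metis Poly_coeffs rangeI subsetI)
  then show ?thesis
    by (rule countable_subset) auto
qed

section \<open>Diagonalization\<close>

text \<open>The Baire category argument for a product of discrete spaces.\<close>

lemma generic_sequence_exists:
  fixes S :: "nat \<Rightarrow> 'a set" and R :: "nat \<Rightarrow> (nat \<Rightarrow> 'a) \<Rightarrow> bool"
  assumes "W\<^sub>0 \<in> Pi UNIV S"
  assumes dense: "\<And>i W N. W \<in> Pi UNIV S \<Longrightarrow> \<exists>W'\<in>Pi UNIV S. \<exists>N'. (\<forall>m<N. W' m = W m) \<and>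
      (\<forall>V\<in>Pi UNIV S. (\<forall>m<N'. V m = W' m) \<longrightarrow> R i V)"
  shows "\<exists>W\<in>Pi UNIV S. \<forall>i. R i W"
proof -
  \<comment> \<open>A stage is a sequence paired with the length of its frozen prefix; stage
    \<open>Suc i\<close> secures requirement \<open>i\<close> for every sequence sharing its
    prefix.\<close>
  define next_stage where "next_stage i a b \<longleftrightarrow> snd a < snd b \<and> (\<forall>m<snd a. fst b m = fst a m) \<and>
      (\<forall>V\<in>Pi UNIV S. (\<forall>m<snd b. V m = fst b m) \<longrightarrow> R i V)"
    for i and a b :: "(nat \<Rightarrow> 'a) \<times> nat"
  have "\<exists>a. \<forall>i. fst (a i) \<in> Pi UNIV S \<and> next_stage i (a i) (a (Suc i))"
  proof (rule dependent_nat_choice)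
    show "\<exists>a :: (nat \<Rightarrow> 'a) \<times> nat. fst a \<in> Pi UNIV S"
      using assms(1) by (intro exI[of _ "(W\<^sub>0, 0)"]) simp
  next
    fix a :: "(nat \<Rightarrow> 'a) \<times> nat" and i
    assume "fst a \<in> Pi UNIV S"
    from dense[OF this, of "snd a" i] obtain W' N' where W': "W' \<in> Pi UNIV S" "\<forall>m<snd a. W' m = fst a m"
      "\<forall>V\<in>Pi UNIV S. (\<forall>m<N'. V m = W' m) \<longrightarrow> R i V"
      by blast
    then show "\<exists>b. fst b \<in> Pi UNIV S \<and> next_stage i a b"
      by (intro exI[of _ "(W', max N' (Suc (snd a)))"]) (simp add: next_stage_def)
  qed
  then obtain a where a: "\<And>i. fst (a i) \<in> Pi UNIV S" "\<And>i. next_stage i (a i) (a (Suc i))"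
    by blast
  define W where "W m = fst (a (Suc m)) m" for m
  have mono: "snd (a i) \<le> snd (a j)" and stable: "\<And>m. m < snd (a i) \<Longrightarrow> fst (a j) m = fst (a i) m"
    if "i \<le> j" for i j
  proof -
    have "snd (a i) \<le> snd (a j) \<and> (\<forall>m<snd (a i). fst (a j) m = fst (a i) m)"
      using that
      by (induction j rule: dec_induct)
        (use a(2) in \<open>auto simp: next_stage_def\<close>,
          (meson a(2) le_less_trans less_imp_le next_stage_def order_less_le_trans)+)
    then show "snd (a i) \<le> snd (a j)" and "\<And>m. m < snd (a i) \<Longrightarrow> fst (a j) m = fst (a i) m"
      by auto
  qed
  have ge: "i \<le> snd (a i)" for i
  proof (induction i)
    case (Suc i)
    then show ?case
      using a(2)[of i] by (simp add: next_stage_def)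
  qed simp
  have limit: "W m = fst (a i) m" if "m < snd (a i)" for m i
    using stable[of i "Suc m" m] stable[of "Suc m" i m] ge[of "Suc m"] that
    unfolding W_def by (metis Suc_le_lessD nat_le_linear)
  have "W \<in> Pi UNIV S"
    using a(1) by (auto simp: W_def Pi_iff)
  moreover have "R i W" for i
    using a(2)[of i] calculation limit[of _ "Suc i"] by (auto simp: next_stage_def)
  ultimately show ?thesis by blast
qed

section \<open>Oracles with one string of each length\<close>

abbreviation strings :: "nat \<Rightarrow> bool list set" where
  "strings n \<equiv> {x. length x = n}"

lemma card_strings: "card (strings n) = 2 ^ n"
  using card_lists_length_eq[of "UNIV :: bool set" n] by (simp add: card_UNIV_bool)

lemma finite_strings_le: "finite {x :: bool list. length x \<le> n}"
  using finite_lists_length_le[of "UNIV :: bool set" n] by simp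

lemma in_range_iff:
  assumes "W \<in> Pi UNIV strings"
  shows "q \<in> range W \<longleftrightarrow> W (length q) = q"
  using assms by (auto simp: Pi_iff image_iff) metis

text \<open>A certificate for \<open>F\<close> on the oracle without \<open>W n\<close>, together
  with the value of \<open>F\<close> there, is too small to cover all strings of length
  \<open>n\<close>. A string \<open>w\<close> outside both can be put in place of \<open>W n\<close>
  without changing that value.\<close>

lemma diagonal_step:
  assumes W: "W \<in> Pi UNIV strings"
    and F: "certifiable c F" "finite (F (range W - {W n}))" "card (F (range W - {W n})) \<le> d"
    and "c + d < 2 ^ n" and "N \<le> n"
  shows "\<exists>W'\<in>Pi UNIV strings. \<exists>N'. (\<forall>m<N. W' m = W m) \<and>
      (\<forall>V\<in>Pi UNIV strings. (\<forall>m<N'. V m = W' m) \<longrightarrow> V n \<notin> F (range V))"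
proof -
  let ?X = "range W - {W n}"
  obtain C where C: "finite C" "card C \<le> c"
    "\<And>Y. (\<And>q. q \<in> C \<Longrightarrow> q \<in> Y \<longleftrightarrow> q \<in> ?X) \<Longrightarrow> F Y = F ?X"
    using certifiableE[OF F(1)] by blast
  have "card (C \<union> F ?X) < card (strings n)"
    using card_Un_le[of C "F ?X"] C(2) F(3) assms(5) card_strings[of n] by linarith
  then have "\<not> strings n \<subseteq> C \<union> F ?X"
    using card_mono[OF finite_UnI[OF C(1) F(2)]] by (meson not_less)
  then obtain w where w: "length w = n" "w \<notin> C" "w \<notin> F ?X"
    by blast
  \<comment> \<open>Agreement below \<open>N'\<close> fixes coordinate \<open>n\<close> and the
    membership of every string in \<open>C\<close>, whatever happens at greater lengths.\<close>
  define N' where "N' = Suc (Max (insert n (length ` C)))"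
  have N': "n < N'" "\<And>q. q \<in> C \<Longrightarrow> length q < N'"
    using C(1) by (auto simp: N'_def less_Suc_eq_le)
  have "V n \<notin> F (range V)" if V: "V \<in> Pi UNIV strings" "\<forall>m<N'. V m = (W(n := w)) m" for V
  proof -
    have "F (range V) = F ?X"
    proof (rule C(3))
      fix q assume q: "q \<in> C"
      have "q \<in> range V \<longleftrightarrow> (W(n := w)) (length q) = q"
        unfolding in_range_iff[OF V(1)] using V(2) N'(2)[OF q] by simp
      moreover have "q \<in> ?X \<longleftrightarrow> length q \<noteq> n \<and> W (length q) = q"
        using W unfolding Diff_iff in_range_iff[OF W] by (auto simp: Pi_iff)
      ultimately show "q \<in> range V \<longleftrightarrow> q \<in> ?X"
        using w q by auto
    qed
    then show ?thesis
      using V(2) N'(1) w(3) by simp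
  qed
  moreover have "W(n := w) \<in> Pi UNIV strings"
    using W w(1) by (auto simp: Pi_iff)
  ultimately show ?thesis
    using \<open>N \<le> n\<close> by (intro bexI[of _ "W(n := w)"] exI[of _ N'] conjI) simp_all
qed

text \<open>Here \<open>f\<close> and \<open>g\<close> bound the lengths of the values of an isomorphism and of its inverse. If the
  set \<open>range W\<close> has one string of each length, then the image of \<open>W n\<close> is among the first
  \<open>1 + g (f n)\<close> elements of the image of \<open>range W\<close>.\<close>

definition evades ::
    "(nat \<Rightarrow> bool list) \<Rightarrow> otm \<Rightarrow> nat poly \<Rightarrow> otm \<Rightarrow> nat poly \<Rightarrow> nat poly \<Rightarrow> bool" where
  "evades W R r G g f \<longleftrightarrow>
     (\<exists>n. W n \<notin> candidates R (poly r (poly f n)) G (poly g (poly f n))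
       (Suc (poly g (poly f n))) (poly f n) (range W))"

lemma evades_dense:
  assumes W: "W \<in> Pi UNIV strings"
  shows "\<exists>W'\<in>Pi UNIV strings. \<exists>N'. (\<forall>m<N. W' m = W m) \<and>
      (\<forall>V\<in>Pi UNIV strings. (\<forall>m<N'. V m = W' m) \<longrightarrow> evades V R r G g f)"
proof -
  \<comment> \<open>At \<open>n\<close> this is the certificate bound plus the bound on the number
    of candidates, with \<open>m = f n\<close> and \<open>K = g m + 1\<close>.\<close>
  define q where "q = (pcompose g f + 2) * (f + 1) * (f * pcompose r f + pcompose g f + 1)"
  have "\<forall>\<^sub>F n in sequentially. N \<le> n \<and> poly q n < 2 ^ n"
    by (intro eventually_conj eventually_ge_at_top eventually_poly_less_power_two)
  then obtain n where n: "N \<le> n" "poly q n < 2 ^ n"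
    using eventually_happens by force
  define m where "m = poly f n"
  define K where "K = Suc (poly g m)"
  have "poly q n = Suc K * Suc m * (m * poly r m + poly g m) + Suc K * Suc m"
    by (simp add: q_def m_def K_def poly_pcompose algebra_simps)
  with n(2) have "Suc K * Suc m * (m * poly r m + poly g m) + Suc K * Suc m < 2 ^ n"
    by (simp only:)
  from diagonal_step[where F = "candidates R (poly r m) G (poly g m) K m",
      OF W certifiable_candidates finite_candidates card_candidates_le this n(1)]
  obtain W' N' where W': "W' \<in> Pi UNIV strings" "\<forall>m<N. W' m = W m"
    "\<forall>V\<in>Pi UNIV strings. (\<forall>m<N'. V m = W' m) \<longrightarrow>
      V n \<notin> candidates R (poly r m) G (poly g m) K m (range V)"
    by (elim bexE exE conjE)
  have "evades V R r G g f" if "V \<in> Pi UNIV strings" "\<forall>m<N'. V m = W' m" for V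
    unfolding evades_def using W'(3)[rule_format, OF that(1)] that(2) by (auto simp: m_def K_def)
  with W'(1,2) show ?thesis
    by blast
qed

lemma evading_sequence_exists:
  "\<exists>W\<in>Pi UNIV strings. \<forall>R r G g f. wf_otm R \<longrightarrow> wf_otm G \<longrightarrow> evades W R r G g f"
proof -
  \<comment> \<open>The isomorphism enters only through its length bound \<open>f\<close>; machines
    are enumerated just for the ranking function and the inverse.\<close>
  define D where "D = {M. wf_otm M} \<times> (UNIV :: nat poly set) \<times> {M. wf_otm M} \<times>
    (UNIV :: nat poly set) \<times> (UNIV :: nat poly set)"
  have "countable D"
    unfolding D_def by (intro countable_SIGMA countable_wf_otm countable_poly)
  define Q where "Q i V = (case from_nat_into D i of (R, r, G, g, f) \<Rightarrow> evades V R r G g f)" for i V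
  have "\<exists>W\<in>Pi UNIV strings. \<forall>i. Q i W"
  proof (rule generic_sequence_exists)
    show "(\<lambda>n. replicate n False) \<in> Pi UNIV strings"
      by simp
  next
    fix i N and W :: "nat \<Rightarrow> bool list"
    assume "W \<in> Pi UNIV strings"
    then show "\<exists>W'\<in>Pi UNIV strings. \<exists>N'. (\<forall>m<N. W' m = W m) \<and>
      (\<forall>V\<in>Pi UNIV strings. (\<forall>m<N'. V m = W' m) \<longrightarrow> Q i V)"
      unfolding Q_def split_beta by (rule evades_dense)
  qed
  then obtain W where W: "W \<in> Pi UNIV strings" "\<And>i. Q i W"
    by blast
  show ?thesis
  proof (intro bexI[OF _ W(1)] allI impI)
    fix R r G g f
    assume "wf_otm R" "wf_otm G"
    then have "(R, r, G, g, f) \<in> D"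
      by (simp add: D_def)
    then obtain i where "from_nat_into D i = (R, r, G, g, f)"
      using from_nat_into_surj[OF \<open>countable D\<close>] by blast
    then show "evades W R r G g f"
      using W(2)[of i] by (simp add: Q_def)
  qed
qed

section \<open>Census and scalability of such oracles\<close>

lemma census_range:
  assumes "W \<in> Pi UNIV strings"
  shows "census (range W) n = 1"
proof -
  have "{x \<in> range W. length x = n} = {W n}"
    using assms in_range_iff[OF assms] by (auto simp: Pi_iff)
  then show ?thesis by (simp add: census_def)
qed

text \<open>On the true oracle the search succeeds for every \<open>n\<close>: the pair formed by
  the rank and the length of \<open>\<phi> (W n)\<close> yields \<open>W n\<close> itself.\<close>

lemma scalable_imp_not_evades:
  assumes W: "W \<in> Pi UNIV strings" and "scalable (range W) (range W)"
  obtains R r G g f where "wf_otm R" "wf_otm G" "\<not> evades W R r G g f"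
proof -
  let ?A = "range W"
  from assms(2) obtain \<phi> where \<phi>: "bij \<phi>" "\<phi> \<in> FP_string ?A" "inv \<phi> \<in> FP_string ?A" "rankable ?A (\<phi> ` ?A)"
    unfolding scalable_def P_isomorphism_def by blast
  from \<phi>(2) obtain M f where M: "wf_otm M" "\<And>x. outputs_within M ?A x (poly f (length x)) (\<phi> x)"
    unfolding FP_def by blast
  from \<phi>(3) obtain G g where G: "wf_otm G" "\<And>x. outputs_within G ?A x (poly g (length x)) (inv \<phi> x)"
    unfolding FP_def by blast
  from \<phi>(4) obtain R r where R: "wf_otm R"
    "\<And>x. outputs_within R ?A x (poly r (length x)) (binary (rank (\<phi> ` ?A) x))"
    unfolding rankable_def FP_def by blast
  have len\<phi>: "length (\<phi> x) \<le> poly f (length x)" for x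
    using length_result_le[OF M(1)] outputs_within_result[OF M(2) order.refl] by metis
  have leninv: "length (inv \<phi> x) \<le> poly g (length x)" for x
    using length_result_le[OF G(1)] outputs_within_result[OF G(2) order.refl] by metis
  have fin: "finite {y \<in> B. y \<le> x}" for B and x :: "bool list"
  proof (rule finite_subset[OF _ finite_strings_le])
    show "{y \<in> B. y \<le> x} \<subseteq> {y. length y \<le> length x}"
      using lenlex_length by (auto simp: list_le_def list_less_def)
  qed
  have "W n \<in> candidates R (poly r (poly f n)) G (poly g (poly f n))
      (Suc (poly g (poly f n))) (poly f n) ?A" for n
  proof -
    define b where "b = \<phi> (W n)"
    define k where "k = rank (\<phi> ` ?A) b"
    let ?m = "poly f n"
    have lenW: "length (W n) = n"
      using W by auto
    have lb: "length b \<le> ?m"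
      using len\<phi>[of "W n"] lenW by (simp add: b_def)
    have "rank (\<phi> ` ?A) y \<ge> k \<longleftrightarrow> b \<le> y" for y
    proof
      assume "b \<le> y"
      then show "rank (\<phi> ` ?A) y \<ge> k"
        unfolding k_def rank_def by (intro card_mono fin) auto
    next
      assume k: "rank (\<phi> ` ?A) y \<ge> k"
      show "b \<le> y"
      proof (rule ccontr)
        assume "\<not> b \<le> y"
        \<comment> \<open>The order is total, so \<open>y < b\<close>; the inclusion is strict
          because \<open>b\<close> belongs only to the right-hand set.\<close>
        then have "{z \<in> \<phi> ` ?A. z \<le> y} \<subset> {z \<in> \<phi> ` ?A. z \<le> b}"
          by (auto simp: b_def)
        from psubset_card_mono[OF fin this] k show False
          by (simp add: k_def rank_def)
      qed
    qed
    then have R_iff: "result R (poly r ?m) y ?A \<in> binary ` {k..} \<longleftrightarrow> b \<le> y"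
      if "length y = length b" for y
      using outputs_within_result[OF R(2)[of y], of "poly r ?m"] poly_nat_mono[of "length y" ?m r] that lb
        inj_image_mem_iff[OF inj_binary] by simp
    have search: "prefix_search (\<lambda>y. result R (poly r ?m) y ?A \<in> binary ` {k..}) (length b) [] = b"
      using prefix_search_eq[of "[]" b] R_iff by simp
    have "inv \<phi> b = W n"
      using \<phi>(1) by (simp add: b_def bij_is_inj)
    then have result: "result G (poly g ?m) b ?A = W n"
      using outputs_within_result[OF G(2)[of b], of "poly g ?m"] poly_nat_mono[OF lb] by simp
    have "k \<le> Suc (poly g ?m)"
    proof -
      \<comment> \<open>The order compares lengths first, so elements up to \<open>b\<close> have
        length at most \<open>?m\<close> and preimages of length at most \<open>poly g ?m\<close>.
        The oracle has one string per length, which bounds the rank.\<close>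
      have "inv \<phi> ` {y \<in> \<phi> ` ?A. y \<le> b} \<subseteq> W ` {..poly g ?m}"
      proof
        fix x assume "x \<in> inv \<phi> ` {y \<in> \<phi> ` ?A. y \<le> b}"
        then obtain l where l: "x = W l" "\<phi> (W l) \<le> b"
          using \<phi>(1) by (auto simp: bij_is_inj)
        then have "length (\<phi> (W l)) \<le> length b"
          using lenlex_length by (auto simp: list_le_def list_less_def)
        then have "length (inv \<phi> (\<phi> (W l))) \<le> poly g ?m"
          using leninv[of "\<phi> (W l)"] poly_nat_mono[of "length (\<phi> (W l))" ?m g] lb by linarith
        moreover have "length (W l) = l"
          using W by auto
        ultimately show "x \<in> W ` {..poly g ?m}"
          using l(1) \<phi>(1) by (auto simp: bij_is_inj)
      qed
      then have "card (inv \<phi> ` {y \<in> \<phi> ` ?A. y \<le> b}) \<le> card (W ` {..poly g ?m})"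
        by (intro card_mono) auto
      also have "\<dots> \<le> Suc (poly g ?m)"
        using card_image_le[of "{..poly g ?m}" W] by simp
      also have "card (inv \<phi> ` {y \<in> \<phi> ` ?A. y \<le> b}) = k"
        using \<phi>(1) unfolding k_def rank_def
        by (intro card_image inj_on_subset[OF bij_is_inj[OF bij_imp_bij_inv]]) auto
      finally show ?thesis .
    qed
    then show "W n \<in> candidates R (poly r ?m) G (poly g ?m) (Suc (poly g ?m)) ?m ?A"
      unfolding candidates_def using lb search result
      by (intro image_eqI[of _ _ "(k, length b)"]) auto
  qed
  then have "\<not> evades W R r G g f"
    by (simp add: evades_def)
  with R(1) G(1) show thesis
    by (rule that)
qed

section \<open>Explicit machines\<close>

lemma tape_string_prefix:
  assumes "\<And>i. i < length x \<Longrightarrow> cells T i = Bit (x ! i)" and "cells T (length x) = Blank"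
  shows "tape_string T = x"
proof -
  have "(LEAST n. \<not> is_Bit (cells T n)) = length x"
    using assms by (intro Least_equality) (auto simp: not_less[symmetric])
  then show ?thesis
    using assms(1) by (auto simp: tape_string_def intro: nth_equalityI)
qed

text \<open>On unary input the first cell is blank or 1, so two transitions suffice; state 1 is
  halting.\<close>

definition one_machine :: otm where
  "one_machine = \<lparr>ntapes = 3, start_state = 0, query_state = 2, yes_state = 1, no_state = 1,
     delta = map_of (map (\<lambda>s. ((0, [s, Blank, Blank]),
       (1, [(s, Stay), (Blank, Stay), (Bit True, Stay)]))) [Blank, Bit True])\<rparr>"

lemma const_one_FP: "(\<lambda>n. 1) \<in> FP X unary binary"
proof -
  let ?M = one_machine
  have "wf_otm ?M"
    unfolding wf_otm_def one_machine_def
    by (auto simp del: map_of.simps simp: finite_dom_map_of dest!: map_of_SomeD)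
  moreover have "outputs_within ?M X (unary n) 1 (binary 1)" for n
  proof -
    let ?s = "if n = 0 then Blank else Bit True"
    let ?c = "\<lparr>state = 1, tapes = [act (?s, Stay) (string_tape (unary n)),
      act (Blank, Stay) (string_tape []), act (Bit True, Stay) (string_tape [])]\<rparr>"
    have "step ?M X (init ?M (unary n)) = ?c"
      by (simp add: step_def init_def one_machine_def numeral_2_eq_2 read_def string_tape_def unary_def)
    moreover have "halted ?M ?c"
      by (simp add: halted_def one_machine_def)
    moreover have "tape_string (act (Bit True, Stay) (string_tape [])) = binary 1"
      by (rule tape_string_prefix) (auto simp: act_def string_tape_def binary.simps)
    ultimately show ?thesis
      unfolding outputs_within_def by (intro exI[of _ 1]) (simp add: numeral_2_eq_2)
  qed
  ultimately show ?thesis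
    unfolding FP_def by (intro CollectI exI[of _ ?M] exI[of _ "[:1:]"]) simp
qed

definition query_machine :: otm where
  "query_machine = \<lparr>ntapes = 3, start_state = 0, query_state = 1, yes_state = 2, no_state = 3,
     delta = map_of
      (map (\<lambda>b. ((0, [Bit b, Blank, Blank]), (0, [(Bit b, MoveRight), (Bit b, MoveRight), (Blank, Stay)])))
          [False, True] @
       [((0, [Blank, Blank, Blank]), (1, [(Blank, Stay), (Blank, Stay), (Blank, Stay)]))] @
       map (\<lambda>b. ((if b then 2 else 3, [Blank, Blank, Blank]),
           (4, [(Blank, Stay), (Blank, Stay), (Bit b, Stay)]))) [False, True])\<rparr>"

text \<open>Invariant of the copying loop, which adds one bit to the query tape per step.\<close>

lemma query_machine_copies:
  assumes "k \<le> length x"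
  shows "(step query_machine X ^^ k) (init query_machine x) =
    \<lparr>state = 0, tapes = [\<lparr>head = k, cells = cells (string_tape x)\<rparr>,
      \<lparr>head = k, cells = cells (string_tape (take k x))\<rparr>, string_tape []]\<rparr>"
  using assms
proof (induction k)
  case 0
  then show ?case
    by (simp add: init_def query_machine_def numeral_2_eq_2 string_tape_def)
next
  case (Suc k)
  have "delta query_machine (0, [Bit b, Blank, Blank]) =
      Some (0, [(Bit b, MoveRight), (Bit b, MoveRight), (Blank, Stay)])" for b
    by (cases b) (simp_all add: query_machine_def)
  moreover have "(cells (string_tape (take k x)))(k := Bit (x ! k)) = cells (string_tape (take (Suc k) x))"
    using Suc.prems by (auto simp: string_tape_def fun_eq_iff less_Suc_eq)
  ultimately show ?case
    using Suc
    by (simp add: step_def read_def act_def string_tape_def fun_upd_idem) (simp add: query_machine_def)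
qed

lemma oracle_in_PTIME: "X \<in> PTIME X"
proof -
  let ?M = query_machine
  have "wf_otm ?M"
    unfolding wf_otm_def query_machine_def
    by (auto simp del: map_of.simps simp: finite_dom_map_of dest!: map_of_SomeD)
  moreover have "outputs_within ?M X x (length x + 3) [x \<in> X]" for x
  proof -
    let ?ts = "[\<lparr>head = length x, cells = cells (string_tape x)\<rparr>,
      \<lparr>head = length x, cells = cells (string_tape x)\<rparr>]"
    let ?out = "act (Bit (x \<in> X), Stay) (string_tape [])"
    have "step ?M X \<lparr>state = 0, tapes = ?ts @ [string_tape []]\<rparr> =
        \<lparr>state = 1, tapes = ?ts @ [string_tape []]\<rparr>"
      by (simp add: step_def query_machine_def read_def act_def string_tape_def fun_upd_idem)
    moreover have "tape_string \<lparr>head = length x, cells = cells (string_tape x)\<rparr> = x"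
      by (rule tape_string_prefix) (auto simp: string_tape_def)
    then have "step ?M X \<lparr>state = 1, tapes = ?ts @ [string_tape []]\<rparr> =
        \<lparr>state = if x \<in> X then 2 else 3, tapes = ?ts @ [string_tape []]\<rparr>"
      by (simp add: step_def query_machine_def)
    moreover have "step ?M X \<lparr>state = if x \<in> X then 2 else 3, tapes = ?ts @ [string_tape []]\<rparr> =
        \<lparr>state = 4, tapes = ?ts @ [?out]\<rparr>"
      by (simp add: step_def query_machine_def read_def act_def string_tape_def fun_upd_idem)
    \<comment> \<open>After the copying, three steps remain: entering the query state, consulting
      the oracle and writing the answer.\<close>
    ultimately have "(step ?M X ^^ (3 + length x)) (init ?M x) = \<lparr>state = 4, tapes = ?ts @ [?out]\<rparr>"
      unfolding funpow_add by (simp add: query_machine_copies numeral_3_eq_3)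
    moreover have "halted ?M \<lparr>state = 4, tapes = ?ts @ [?out]\<rparr>"
      by (simp add: halted_def query_machine_def)
    moreover have "tape_string ?out = [x \<in> X]"
      by (rule tape_string_prefix) (auto simp: act_def string_tape_def)
    ultimately show ?thesis
      unfolding outputs_within_def
      by (intro exI[of _ "length x + 3"]) (simp add: add.commute numeral_2_eq_2)
  qed
  then have "\<forall>x. outputs_within ?M X x (poly [:3, 1:] (length x)) [x \<in> X]"
    by (simp add: add.commute)
  ultimately show ?thesis
    unfolding PTIME_def FP_def by blast
qed

theorem theorem5p5:
  shows "\<exists>A :: bool list set. A \<in> PTIME A \<and> \<not> scalable A A \<and> census A \<in> FP A unary binary"
proof -
  obtain W where W: "W \<in> Pi UNIV strings"
    "\<forall>R r G g f. wf_otm R \<longrightarrow> wf_otm G \<longrightarrow> evades W R r G g f"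
    using evading_sequence_exists by (rule bexE)
  have "\<not> scalable (range W) (range W)"
  proof
    assume "scalable (range W) (range W)"
    with W(1) obtain R r G g f where "wf_otm R" "wf_otm G" "\<not> evades W R r G g f"
      by (rule scalable_imp_not_evades)
    with W(2) show False by blast
  qed
  moreover have "census (range W) = (\<lambda>n. 1)"
    using census_range[OF W(1)] by (rule ext)
  ultimately have "range W \<in> PTIME (range W) \<and> \<not> scalable (range W) (range W) \<and>
      census (range W) \<in> FP (range W) unary binary"
    using oracle_in_PTIME const_one_FP by (simp only: simp_thms)
  then show ?thesis by (rule exI)
qed

end
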